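(* The map $\pi:X\to\mathcal O_3$ is at most countable-to-one, i.e. $\pi^{-1}(\{\delta\})$ is at most countable for every $\delta\in\mathcal O_3$.
   Context: $\mathbb N$ is the set of non-negative integers. For $n\ge1$ let $A_n=\{0,\dots,n\}$ and let $\tau_n:A_n\to A_n^3$ be the primitive substitution $\tau_n(a)=a\,0\,(a+1)$ if $a\ne n$ and $\tau_n(n)=n\,0\,n$, extended by concatenation to finite words and to $A_n^{\mathbb Z}$ (with $\tau_n(x)=\dots\tau_n(x_{-1}).\tau_n(x_0)\tau_n(x_1)\dots$, the dot preceding coordinate $0$). $X_n$ is the smallest subshift (closed shift-invariant subset) of $A_n^{\mathbb Z}$ in which all words $\tau_n^k(a)$, $k\ge0$, $a\in A_n$, appear; it is infinite. $T_n$ is the shift $T_n((x_i)_i)=(x_{i+1})_i$ on $X_n$. Let $\rho_n:A_{n+1}\to A_n$, $\rho_n(a)=a$ if $a\ne n+1$ and $\rho_n(n+1)=n$; applied coordinatewise it defines a factor map $\rho_n:X_{n+1}\to X_n$. Let $$X=\{(x_n)_{n\ge1}\in\prod_{n\ge1}X_n:\ \rho_n(x_{n+1})=x_n\ \ \forall n\ge1\},\qquad T((x_n)_{n\ge1})=(T_n(x_n))_{n\ge1}.$$ $\mathcal O_3=\{0,1,2\}^{\mathbb N}$ is the $3$-odometer (the $3$-adic integers with addition of $1$, via $(\delta_i)\mapsto\sum\delta_i3^i$). For $z\in X_n$, by known results (Dekking, Mossé) there are unique sequences $(z^{(i)})_{i\in\mathbb N}$ in $X_n$ and $(\delta_i)_{i\in\mathbb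 N}$ in $\{0,1,2\}$ with $z^{(0)}=z$ and $z^{(i)}=T_n^{\delta_i}\tau_n(z^{(i+1)})$ for all $i\ge0$; put $\pi_n(z)=(\delta_i)_{i\in\mathbb N}\in\mathcal O_3$. For $x=(x_n)_{n\ge1}\in X$ the value $\pi_n(x_n)$ does not depend on $n$, and $\pi(x)$ denotes this common value. *)

theory Defs
  imports "HOL-Analysis.Function_Topology"
begin

text \<open>Letters are natural numbers, finite words are lists, and bi-infinite words are functions
  \<^typ>\<open>int \<Rightarrow> nat\<close>.\<close>

definition alphabet :: "nat \<Rightarrow> nat set" where
  "alphabet n = {0..n}"

definition tau :: "nat \<Rightarrow> nat \<Rightarrow> nat list" where
  "tau n a = (if a = n then [n, 0, n] else [a, 0, a + 1])"

definition tau_word :: "nat \<Rightarrow> nat list \<Rightarrow> nat list" where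
  "tau_word n w = concat (map (tau n) w)"

text \<open>All words \<open>tau n a\<close> have length 3. Integer division rounds towards minus infinity, so that
  the block at coordinates \<open>3 * j\<close>, \<open>3 * j + 1\<close>, \<open>3 * j + 2\<close> is \<open>tau n (x j)\<close>, also for
  negative \<open>j\<close>.\<close>

definition tau_bi :: "nat \<Rightarrow> (int \<Rightarrow> nat) \<Rightarrow> (int \<Rightarrow> nat)" where
  "tau_bi n x = (\<lambda>i. tau n (x (i div 3)) ! nat (i mod 3))"

definition shift :: "(int \<Rightarrow> nat) \<Rightarrow> (int \<Rightarrow> nat)" where
  "shift x = (\<lambda>i. x (i + 1))"

text \<open>The topology on \<^typ>\<open>int \<Rightarrow> nat\<close> is the product of the discrete topologies. The full shift
  over \<open>alphabet n\<close> is closed in it, hence closedness in the full shift and in the whole type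
  agree for subsets of the full shift.\<close>

definition is_subshift :: "nat set \<Rightarrow> (int \<Rightarrow> nat) set \<Rightarrow> bool" where
  "is_subshift A Y \<longleftrightarrow> Y \<subseteq> {x. \<forall>i. x i \<in> A} \<and> closed Y \<and> shift ` Y = Y"

definition appears_in :: "nat list \<Rightarrow> (int \<Rightarrow> nat) set \<Rightarrow> bool" where
  "appears_in w Y \<longleftrightarrow> (\<exists>y\<in>Y. \<exists>j::int. \<forall>i<length w. y (j + int i) = w ! i)"

text \<open>The smallest subshift in which all words \<open>(tau_word n ^^ k) [a]\<close> appear.\<close>

definition Xn :: "nat \<Rightarrow> (int \<Rightarrow> nat) set" where
  "Xn n = \<Inter> {Y. is_subshift (alphabet n) Y \<and>
                (\<forall>k. \<forall>a\<in>alphabet n. appears_in ((tau_word n ^^ k) [a]) Y)}"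

definition rho :: "nat \<Rightarrow> nat \<Rightarrow> nat" where
  "rho n a = (if a = n + 1 then n else a)"

text \<open>The index set of the inverse limit is \<open>{1..}\<close>; the extensional product fixes the irrelevant
  value at index 0, so that points of the inverse limit are not counted repeatedly.\<close>

definition inv_lim :: "(nat \<Rightarrow> int \<Rightarrow> nat) set" where
  "inv_lim = {x \<in> (\<Pi>\<^sub>E n\<in>{1..}. Xn n). \<forall>n\<ge>1. rho n \<circ> x (n + 1) = x n}"

definition odometer3 :: "(nat \<Rightarrow> nat) set" where
  "odometer3 = {\<delta>. \<forall>i. \<delta> i \<in> {0, 1, 2}}"

definition desubstitution ::
  "nat \<Rightarrow> (int \<Rightarrow> nat) \<Rightarrow> (nat \<Rightarrow> int \<Rightarrow> nat) \<Rightarrow> (nat \<Rightarrow> nat) \<Rightarrow> bool" where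
  "desubstitution n z zs \<delta> \<longleftrightarrow>
     (\<forall>i. zs i \<in> Xn n) \<and> \<delta> \<in> odometer3 \<and> zs 0 = z \<and>
     (\<forall>i. zs i = (shift ^^ \<delta> i) (tau_bi n (zs (i + 1))))"

text \<open>For \<open>n \<ge> 1\<close> and \<open>z \<in> Xn n\<close> the pair \<open>(zs, \<delta>)\<close> exists and is unique, by recognizability of
  \<open>tau n\<close> (Dekking, Mosse).\<close>

definition pi_n :: "nat \<Rightarrow> (int \<Rightarrow> nat) \<Rightarrow> (nat \<Rightarrow> nat)" where
  "pi_n n z = (THE \<delta>. \<exists>zs. desubstitution n z zs \<delta>)"

text \<open>On \<^const>\<open>inv_lim\<close> the value \<open>pi_n n (x n)\<close> does not depend on \<open>n \<ge> 1\<close>.\<close>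

definition pi_lim :: "(nat \<Rightarrow> int \<Rightarrow> nat) \<Rightarrow> (nat \<Rightarrow> nat)" where
  "pi_lim x = (THE \<delta>. \<forall>n\<ge>1. pi_n n (x n) = \<delta>)"

end

theory Submission
  imports Defs
begin

text \<open>
  For a point \<open>x\<close> of the inverse limit, \<open>pi_lim x = \<delta>\<close> means that every \<open>x n\<close> can be desubstituted
  infinitely often with the phases \<open>\<delta> 0, \<delta> 1, \<dots>\<close>. The letter of the \<open>k\<close>-th desubstitution at
  coordinate \<open>j\<close> is the entry number \<open>(j + \<delta> k) mod 3\<close> of the block generated by the letter of the
  next desubstitution at \<open>(j + \<delta> k) div 3\<close>. So each coordinate \<open>i\<close> of \<open>x\<close> has a path of ancestors,
  and each letter on a path determines the letters below it.

  Two facts make the fibre countable. First, a letter over all alphabets together is an element of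
  the inverse limit of the alphabets, which is a copy of the natural numbers with infinity
  (\<open>countable_compatible\<close>). Over this infinite alphabet the substitution is \<open>a \<mapsto> a 0 (a + 1)\<close>, so a
  letter at the first or third place determines its parent (\<open>tower_parent\<close>), while a letter at the
  middle place is \<open>0\<close> in any case. Consequently a whole path is determined by one of its letters, at a
  level that depends only on \<open>\<delta>\<close> and the path (\<open>tower_path_anchor\<close>). Second, since coordinates shrink to
  \<open>{-1, 0, 1}\<close> along paths, at most three paths are needed for every other path to meet one of them
  (\<open>three_representatives\<close>). Hence \<open>x\<close> is determined by three elements of a countable set
  (\<open>countable_towers\<close>).

  That \<open>pi_lim\<close> really yields such phases rests on existence and uniqueness of desubstitution. Both
  follow from the description of \<open>Xn n\<close> as the orbit closure of a fixed point of the substitution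
  (\<open>Xn_eq_fixpoint_closure\<close>): existence by a pigeonhole argument on the phase, uniqueness because the
  zeros of a point reveal the middle places of its blocks (\<open>phase_unique\<close>).
\<close>

section \<open>The product topology and translations\<close>

text \<open>The windows around the origin give a neighbourhood base of a point, as the letters carry the
  discrete topology.\<close>

lemma closed_iff_window_approx:
  fixes Y :: "(int \<Rightarrow> nat) set"
  shows "closed Y \<longleftrightarrow>
    (\<forall>z. (\<forall>m. \<exists>y\<in>Y. \<forall>i. \<bar>i\<bar> \<le> int m \<longrightarrow> y i = z i) \<longrightarrow> z \<in> Y)"
proof (intro iffI allI impI)
  fix z assume cl: "closed Y" and *: "\<forall>m. \<exists>y\<in>Y. \<forall>i. \<bar>i\<bar> \<le> int m \<longrightarrow> y i = z i"
  obtain y where y: "\<And>m. y m \<in> Y" "\<And>m i. \<bar>i\<bar> \<le> int m \<Longrightarrow> y m i = z i"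
    using * by metis
  have "(\<lambda>m. y m i) \<longlonglongrightarrow> z i" for i
    by (rule tendsto_eventually, rule eventually_sequentiallyI[of "nat \<bar>i\<bar>"]) (simp add: y(2))
  then have "y \<longlonglongrightarrow> z"
    using limitin_componentwise[of "\<lambda>_. euclidean" UNIV y z sequentially]
    by (simp add: euclidean_product_topology)
  then show "z \<in> Y"
    using cl y(1) closed_sequentially by blast
next
  assume *: "\<forall>z. (\<forall>m. \<exists>y\<in>Y. \<forall>i. \<bar>i\<bar> \<le> int m \<longrightarrow> y i = z i) \<longrightarrow> z \<in> Y"
  have "z \<in> Y" if z: "z \<in> closure Y" for z
  proof -
    have "\<exists>y\<in>Y. \<forall>i. \<bar>i\<bar> \<le> int m \<longrightarrow> y i = z i" for m
    proof -
      let ?U = "\<Inter>i\<in>{-int m..int m}. (\<lambda>y. y i) -` {z i}"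
      have "open ?U"
        by (intro open_INT finite_atLeastAtMost_int ballI open_vimage open_discrete)
          (simp add: continuous_on_product_coordinates)
      moreover have "z \<in> ?U" by simp
      ultimately obtain y where "y \<in> Y" "y \<in> ?U"
        using z closure_iff_nhds_not_empty[of z Y] by blast
      moreover have "i \<in> {-int m..int m}" if "\<bar>i\<bar> \<le> int m" for i using that by auto
      ultimately show ?thesis by (intro bexI[of _ y]) auto
    qed
    then show ?thesis using * by blast
  qed
  then have "closure Y \<subseteq> Y" by (rule subsetI)
  then show "closed Y" by (simp add: closure_subset_eq)
qed

lemma funpow_shift: "(shift ^^ d) x i = x (i + int d)"
  by (induction d arbitrary: i) (auto simp: shift_def algebra_simps)

lemma subshift_translate:
  assumes inv: "shift ` Y = Y" and y: "y \<in> Y"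
  shows "(\<lambda>i. y (i + c)) \<in> Y"
proof (induction c rule: int_induct[where k = 0])
  case base
  then show ?case using y by simp
next
  case (step1 c)
  then have "shift (\<lambda>i. y (i + c)) \<in> Y" using inv by blast
  then show ?case by (simp add: shift_def algebra_simps)
next
  case (step2 c)
  then obtain w where w: "w \<in> Y" "(\<lambda>i. y (i + c)) = shift w" using inv by blast
  have "w i = y (i + (c - 1))" for i
    using fun_cong[OF w(2), of "i - 1"] by (simp add: shift_def algebra_simps)
  then have "w = (\<lambda>i. y (i + (c - 1)))" by blast
  then show ?case using w(1) by simp
qed

section \<open>The bi-infinite fixed point of the substitution\<close>

lemma tau_nth:
  "tau n a ! 0 = a" "tau n a ! Suc 0 = 0" "tau n a ! 2 = (if a = n then n else a + 1)"
  "length (tau n a) = 3"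
  by (auto simp: tau_def)

lemma tau_nth_le: "a \<le> n \<Longrightarrow> r < 3 \<Longrightarrow> tau n a ! r \<le> n"
  by (auto simp: tau_def less_Suc_eq numeral_3_eq_3)

lemma rho_tau:
  assumes "a \<le> n + 1" "r < 3"
  shows "rho n (tau (n + 1) a ! r) = tau n (rho n a) ! r"
  using assms by (auto simp: tau_def rho_def less_Suc_eq numeral_3_eq_3)

text \<open>The fixed point \<open>u\<close> of \<^term>\<open>tau_bi n\<close> with \<open>u (-1) = n\<close> and \<open>u 0 = 0\<close>; this seed is
  consistent because \<open>tau n n\<close> ends in \<open>n\<close> and \<open>tau n 0\<close> starts with \<open>0\<close>. The value at \<open>i\<close> is
  computed from the base-3 digits of \<open>i\<close>, and \<open>i = 0\<close>, \<open>i = -1\<close> are the two integers with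
  \<open>i div 3 = i\<close>.\<close>

function fixpoint :: "nat \<Rightarrow> int \<Rightarrow> nat" where
  "fixpoint n i = (if i = 0 then 0 else if i = -1 then n
     else tau n (fixpoint n (i div 3)) ! nat (i mod 3))"
  by auto
termination by (relation "measure (\<lambda>(n, i). nat \<bar>i\<bar>)") auto

declare fixpoint.simps[simp del]

lemma fixpoint_0: "fixpoint n 0 = 0" and fixpoint_m1: "fixpoint n (-1) = n"
  by (auto simp: fixpoint.simps)

lemma fixpoint_rec: "fixpoint n i = tau n (fixpoint n (i div 3)) ! nat (i mod 3)"
proof (cases "i = 0 \<or> i = -1")
  case True
  then show ?thesis by (auto simp: fixpoint_0 fixpoint_m1 tau_nth)
next
  case False
  then show ?thesis by (subst fixpoint.simps) simp
qed

lemma fixpoint_block: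
  "0 \<le> r \<Longrightarrow> r < 3 \<Longrightarrow> fixpoint n (3 * j + r) = tau n (fixpoint n j) ! nat r"
  by (subst fixpoint_rec) simp

lemma fixpoint_le: "fixpoint n i \<le> n"
proof (induction n i rule: fixpoint.induct)
  case (1 n i)
  have "nat (i mod 3) < 3" by (simp add: nat_less_iff)
  with 1 show ?case by (subst fixpoint.simps) (auto intro!: tau_nth_le)
qed

text \<open>The letter map commutes with the substitutions (\<open>rho_tau\<close>), and it maps the seed at level
  \<open>n + 1\<close> to the seed at level \<open>n\<close>.\<close>

lemma rho_fixpoint: "rho n (fixpoint (n + 1) i) = fixpoint n i"
proof (induction n i rule: fixpoint.induct)
  case (1 n i)
  have r: "nat (i mod 3) < 3" by (simp add: nat_less_iff)
  show ?case
  proof (cases "i = 0 \<or> i = -1")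
    case True
    then show ?thesis by (auto simp: fixpoint_0 fixpoint_m1 rho_def)
  next
    case False
    then have "rho n (fixpoint (n + 1) (i div 3)) = fixpoint n (i div 3)" using 1 by blast
    moreover have "rho n (fixpoint (n + 1) i)
        = tau n (rho n (fixpoint (n + 1) (i div 3))) ! nat (i mod 3)"
      by (subst fixpoint_rec, rule rho_tau[OF fixpoint_le r])
    ultimately show ?thesis using fixpoint_rec[of n i] by simp
  qed
qed

text \<open>Third letters of blocks are successors or \<open>n\<close>. This separates them from the middle letters and
  makes the phase of a point recognizable.\<close>

lemma fixpoint_third_nonzero: "1 \<le> n \<Longrightarrow> fixpoint n (3 * j + 2) \<noteq> 0"
  by (simp add: fixpoint_block tau_nth)

lemma fixpoint_letter: "a \<le> n \<Longrightarrow> \<exists>p. fixpoint n p = a"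
proof (induction a)
  case 0
  then show ?case using fixpoint_0 by blast
next
  case (Suc a)
  then obtain p where "fixpoint n p = a" by auto
  then have "fixpoint n (3 * p + 2) = Suc a"
    using Suc.prems by (simp add: fixpoint_block tau_nth)
  then show ?case by blast
qed

text \<open>Equal letters generate equal blocks of length \<open>3 ^ k\<close>. This allows words around the origin to
  be found again strictly inside a block generated by a single letter.\<close>

lemma fixpoint_power_block:
  assumes "fixpoint n p = fixpoint n q" "0 \<le> t" "t < 3 ^ k"
  shows "fixpoint n (3 ^ k * p + t) = fixpoint n (3 ^ k * q + t)"
  using assms(2,3)
proof (induction k arbitrary: t)
  case 0
  then have "t = 0" by simp
  then show ?case using assms(1) by simp
next
  case (Suc k)
  have split: "(3 ^ Suc k * j + t) div 3 = 3 ^ k * j + t div 3"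
              "(3 ^ Suc k * j + t) mod 3 = t mod 3" for j :: int
    by (simp_all add: mult.assoc)
  have "fixpoint n (3 ^ k * p + t div 3) = fixpoint n (3 ^ k * q + t div 3)"
    using Suc by auto
  then show ?case
    using fixpoint_rec[of n "3 ^ Suc k * p + t"] fixpoint_rec[of n "3 ^ Suc k * q + t"]
    unfolding split by simp
qed

lemma length_tau_word: "length (tau_word n w) = 3 * length w"
  by (induction w) (auto simp: tau_word_def tau_nth)

lemma tau_word_nth: "t < 3 * length w \<Longrightarrow> tau_word n w ! t = tau n (w ! (t div 3)) ! (t mod 3)"
proof (induction w arbitrary: t)
  case Nil
  then show ?case by simp
next
  case (Cons a w)
  show ?case
  proof (cases "t < 3")
    case True
    then show ?thesis by (simp add: tau_word_def nth_append tau_nth)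
  next
    case False
    then obtain s where s: "t = s + 3" using le_Suc_ex[of 3 t] by (metis add.commute not_le)
    then have "tau_word n (a # w) ! t = tau_word n w ! s"
      by (simp add: tau_word_def nth_append tau_nth)
    then show ?thesis using Cons s by simp
  qed
qed

lemma length_tau_power: "length ((tau_word n ^^ k) [a]) = 3 ^ k"
  by (induction k) (auto simp: length_tau_word)

lemma tau_power_in_fixpoint:
  assumes "fixpoint n p = a" "t < 3 ^ k"
  shows "fixpoint n (3 ^ k * p + int t) = (tau_word n ^^ k) [a] ! t"
  using assms(2)
proof (induction k arbitrary: t)
  case 0
  then show ?case using assms(1) by simp
next
  case (Suc k)
  have "(3 ^ Suc k * p + int t) div 3 = 3 ^ k * p + int (t div 3)"
       "(3 ^ Suc k * p + int t) mod 3 = int (t mod 3)"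
    by (simp_all add: mult.assoc zdiv_int zmod_int)
  then have "fixpoint n (3 ^ Suc k * p + int t)
      = tau n (fixpoint n (3 ^ k * p + int (t div 3))) ! (t mod 3)"
    by (subst fixpoint_rec) simp
  also have "\<dots> = tau n ((tau_word n ^^ k) [a] ! (t div 3)) ! (t mod 3)"
    using Suc by simp
  also have "\<dots> = (tau_word n ^^ Suc k) [a] ! t"
    using Suc.prems by (simp add: tau_word_nth length_tau_power)
  finally show ?case .
qed

section \<open>The subshift as an orbit closure\<close>

text \<open>Windows centred at \<open>0\<close> are enough to describe the orbit closure, since their position \<open>p\<close> in the
  fixed point is arbitrary.\<close>

definition fixpoint_closure :: "nat \<Rightarrow> (int \<Rightarrow> nat) set" where
  "fixpoint_closure n = {z. \<forall>m. \<exists>p. \<forall>i. \<bar>i\<bar> \<le> int m \<longrightarrow> z i = fixpoint n (p + i)}"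

lemma fixpoint_closure_translate:
  assumes "z \<in> fixpoint_closure n"
  shows "(\<lambda>i. z (i + c)) \<in> fixpoint_closure n"
  unfolding fixpoint_closure_def
proof (intro CollectI allI)
  fix m
  obtain p where p: "\<And>i. \<bar>i\<bar> \<le> int (m + nat \<bar>c\<bar>) \<Longrightarrow> z i = fixpoint n (p + i)"
    using assms unfolding fixpoint_closure_def by blast
  have "z (i + c) = fixpoint n ((p + c) + i)" if "\<bar>i\<bar> \<le> int m" for i
    using p[of "i + c"] that by (simp add: algebra_simps)
  then show "\<exists>p. \<forall>i. \<bar>i\<bar> \<le> int m \<longrightarrow> z (i + c) = fixpoint n (p + i)" by blast
qed

lemma fixpoint_closure_subshift: "is_subshift (alphabet n) (fixpoint_closure n)"
  unfolding is_subshift_def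
proof (intro conjI)
  show "fixpoint_closure n \<subseteq> {x. \<forall>i. x i \<in> alphabet n}"
  proof (intro subsetI CollectI allI)
    fix z i assume "z \<in> fixpoint_closure n"
    then obtain p where "\<forall>j. \<bar>j\<bar> \<le> int (nat \<bar>i\<bar>) \<longrightarrow> z j = fixpoint n (p + j)"
      unfolding fixpoint_closure_def by blast
    then have "z i = fixpoint n (p + i)" by simp
    then show "z i \<in> alphabet n" by (simp add: alphabet_def fixpoint_le)
  qed
  show "closed (fixpoint_closure n)"
    unfolding closed_iff_window_approx
  proof (intro allI impI)
    fix z assume *: "\<forall>m. \<exists>y\<in>fixpoint_closure n. \<forall>i. \<bar>i\<bar> \<le> int m \<longrightarrow> y i = z i"
    have "\<exists>p. \<forall>i. \<bar>i\<bar> \<le> int m \<longrightarrow> z i = fixpoint n (p + i)" for m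
    proof -
      obtain y where y: "y \<in> fixpoint_closure n" "\<And>i. \<bar>i\<bar> \<le> int m \<Longrightarrow> y i = z i"
        using * by blast
      from y(1) obtain p where "\<forall>i. \<bar>i\<bar> \<le> int m \<longrightarrow> y i = fixpoint n (p + i)"
        unfolding fixpoint_closure_def by blast
      with y(2) show ?thesis by (intro exI[of _ p]) simp
    qed
    then show "z \<in> fixpoint_closure n" unfolding fixpoint_closure_def by blast
  qed
  show "shift ` fixpoint_closure n = fixpoint_closure n"
  proof (intro equalityI subsetI)
    fix z assume "z \<in> shift ` fixpoint_closure n"
    then show "z \<in> fixpoint_closure n"
      using fixpoint_closure_translate[of _ n 1] by (auto simp: shift_def)
  next
    fix z assume "z \<in> fixpoint_closure n"
    then have "(\<lambda>i. z (i + (-1))) \<in> fixpoint_closure n" by (rule fixpoint_closure_translate)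
    moreover have "z = shift (\<lambda>i. z (i + (-1)))" by (simp add: shift_def)
    ultimately show "z \<in> shift ` fixpoint_closure n" by blast
  qed
qed

text \<open>Any admissible subshift contains the word \<open>tau^(k+1) n\<close>, which begins with
  \<open>tau^k n tau^k 0\<close>; that prefix is the central window of the fixed point, on both sides of the
  origin. So an admissible subshift contains all limits of translates of the fixed point, while the
  orbit closure is itself admissible.\<close>

lemma Xn_eq_fixpoint_closure: "Xn n = fixpoint_closure n"
proof (intro equalityI)
  have "appears_in ((tau_word n ^^ k) [a]) (fixpoint_closure n)" if "a \<in> alphabet n" for k a
  proof -
    have "a \<le> n" using that by (simp add: alphabet_def)
    then obtain p where p: "fixpoint n p = a" using fixpoint_letter by blast
    have "fixpoint n \<in> fixpoint_closure n"
      unfolding fixpoint_closure_def by (auto intro: exI[of _ 0])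
    moreover have "\<forall>t<3 ^ k. fixpoint n (3 ^ k * p + int t) = (tau_word n ^^ k) [a] ! t"
      using tau_power_in_fixpoint[OF p] by simp
    ultimately show ?thesis
      unfolding appears_in_def length_tau_power by (intro bexI exI)
  qed
  then show "Xn n \<subseteq> fixpoint_closure n"
    unfolding Xn_def using fixpoint_closure_subshift by (intro Inter_lower) simp
next
  show "fixpoint_closure n \<subseteq> Xn n"
    unfolding Xn_def
  proof (intro subsetI InterI, elim CollectE conjE)
    fix z Y assume z: "z \<in> fixpoint_closure n" and sub: "is_subshift (alphabet n) Y"
      and words: "\<forall>k. \<forall>a\<in>alphabet n. appears_in ((tau_word n ^^ k) [a]) Y"
    have "\<exists>y\<in>Y. \<forall>i. \<bar>i\<bar> \<le> int m \<longrightarrow> y i = z i" for m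
    proof -
      obtain p where p: "\<And>i. \<bar>i\<bar> \<le> int m \<Longrightarrow> z i = fixpoint n (p + i)"
        using z unfolding fixpoint_closure_def by blast
      define k where "k = nat (\<bar>p\<bar> + int m + 1)"
      have "k < 3 ^ k" by (rule power_gt_expt) simp
      then have "int k < 3 ^ k" by (metis of_nat_less_iff of_nat_power of_nat_numeral)
      then have bound: "\<bar>p\<bar> + int m < 3 ^ k" unfolding k_def by linarith
      have "n \<in> alphabet n" by (simp add: alphabet_def)
      then have "appears_in ((tau_word n ^^ Suc k) [n]) Y" using words by blast
      then obtain y j where y: "y \<in> Y"
        and yj: "\<forall>t<3 ^ Suc k. y (j + int t) = (tau_word n ^^ Suc k) [n] ! t"
        unfolding appears_in_def length_tau_power by blast
      have u: "y (j + 3 ^ k + s) = fixpoint n s" if s: "- (3 ^ k) \<le> s" "s < 3 ^ k" for s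
      proof -
        define t where "t = nat (s + 3 ^ k)"
        have t: "int t = s + 3 ^ k" unfolding t_def using s by simp
        have "int t < int (3 ^ Suc k)" unfolding t using s by simp
        then have t': "t < 3 ^ Suc k" by linarith
        have "y (j + 3 ^ k + s) = y (j + int t)" unfolding t by (simp add: algebra_simps)
        also have "\<dots> = fixpoint n (3 ^ Suc k * (-1) + int t)"
          using yj[rule_format, OF t'] tau_power_in_fixpoint[OF fixpoint_m1 t'] by simp
        \<comment> \<open>The letters at \<open>-3\<close>, \<open>-2\<close> are \<open>n\<close>, \<open>0\<close>, as at \<open>-1\<close>, \<open>0\<close>, so their blocks agree too.\<close>
        also have "\<dots> = fixpoint n (3 ^ k * (-2) + s)" unfolding t by (simp add: algebra_simps)
        also have "\<dots> = fixpoint n s"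
        proof (cases "0 \<le> s")
          case True
          have "fixpoint n (-2) = fixpoint n 0"
            using fixpoint_block[of 1 n "-1"] by (simp add: fixpoint_0 tau_nth)
          from fixpoint_power_block[OF this True s(2)] show ?thesis by simp
        next
          case False
          have "fixpoint n (-3) = fixpoint n (-1)"
            using fixpoint_block[of 0 n "-1"] by (simp add: fixpoint_m1 tau_nth)
          from fixpoint_power_block[OF this, of "s + 3 ^ k" k] False s(1)
          show ?thesis by (simp add: algebra_simps)
        qed
        finally show ?thesis .
      qed
      have "(\<lambda>i. y (i + (j + 3 ^ k + p))) \<in> Y"
        using subshift_translate[OF _ y] sub unfolding is_subshift_def by blast
      moreover have "y (i + (j + 3 ^ k + p)) = z i" if i: "\<bar>i\<bar> \<le> int m" for i
      proof -
        have "y (j + 3 ^ k + (p + i)) = fixpoint n (p + i)" by (rule u) (use i bound in linarith)+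
        then show ?thesis using p[OF i] by (simp add: algebra_simps)
      qed
      ultimately show ?thesis by (intro bexI[of _ "\<lambda>i. y (i + (j + 3 ^ k + p))"]) simp_all
    qed
    moreover have "closed Y" using sub unfolding is_subshift_def by (elim conjE)
    ultimately show "z \<in> Y"
      by (intro closed_iff_window_approx[THEN iffD1, rule_format, of Y z]) simp_all
  qed
qed

lemma Xn_window:
  "z \<in> Xn n \<Longrightarrow> \<exists>p. \<forall>i. \<bar>i\<bar> \<le> int m \<longrightarrow> z i = fixpoint n (p + i)"
  by (simp add: Xn_eq_fixpoint_closure fixpoint_closure_def)

lemma Xn_le: "z \<in> Xn n \<Longrightarrow> z i \<le> n"
  using Xn_window[of z n "nat \<bar>i\<bar>"] fixpoint_le by fastforce

lemma rho_Xn: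
  assumes "z \<in> Xn (n + 1)"
  shows "rho n \<circ> z \<in> Xn n"
proof -
  have "\<exists>p. \<forall>i. \<bar>i\<bar> \<le> int m \<longrightarrow> (rho n \<circ> z) i = fixpoint n (p + i)" for m
  proof -
    obtain p where "\<forall>i. \<bar>i\<bar> \<le> int m \<longrightarrow> z i = fixpoint (n + 1) (p + i)"
      using Xn_window[OF assms] by blast
    then have "\<forall>i. \<bar>i\<bar> \<le> int m \<longrightarrow> (rho n \<circ> z) i = fixpoint n (p + i)"
      using rho_fixpoint by simp
    then show ?thesis by blast
  qed
  then show ?thesis by (simp add: Xn_eq_fixpoint_closure fixpoint_closure_def)
qed

lemma shift_tau_bi:
  "(shift ^^ d) (tau_bi n x) i = tau n (x ((i + int d) div 3)) ! nat ((i + int d) mod 3)"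
  by (simp add: funpow_shift tau_bi_def)

section \<open>Existence and uniqueness of desubstitution\<close>

text \<open>Every window of \<open>z\<close> is a window of the fixed point, hence cut into blocks with some phase in
  \<open>{0, 1, 2}\<close>. One phase must work for arbitrarily large windows, and then it works for all of
  them. The first letters of the blocks form \<open>z'\<close>, whose windows again lie in the fixed point.\<close>

lemma desubstitute_once:
  assumes z: "z \<in> Xn n"
  shows "\<exists>d z'. d \<in> {0, 1, 2} \<and> z' \<in> Xn n \<and> z = (shift ^^ d) (tau_bi n z')"
proof -
  let ?ok = "\<lambda>d m. \<exists>q. \<forall>i. \<bar>i\<bar> \<le> int m \<longrightarrow> z i = fixpoint n (3 * q + int d + i)"
  have "\<exists>d\<in>{0, 1, 2}. \<forall>m. ?ok d m"
  proof (rule ccontr)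
    assume "\<not> ?thesis"
    then have "\<forall>d\<in>{0, 1, 2}. \<exists>m. \<not> ?ok d m" by simp
    then obtain f where f: "\<forall>d\<in>{0, 1, 2}. \<not> ?ok d (f d)" by metis
    \<comment> \<open>A window so large that its phase contradicts the assumed failure of that phase.\<close>
    define m where "m = Max (f ` {0, 1, 2})"
    obtain p where p: "\<forall>i. \<bar>i\<bar> \<le> int m \<longrightarrow> z i = fixpoint n (p + i)"
      using Xn_window[OF z] by blast
    define d where "d = nat (p mod 3)"
    have d: "d \<in> {0, 1, 2}" unfolding d_def by auto
    have "f d \<le> m" unfolding m_def using d by (intro Max_ge) auto
    moreover have "3 * (p div 3) + int d = p" unfolding d_def by simp
    ultimately have "?ok d (f d)" using p by (intro exI[of _ "p div 3"]) simp
    then show False using f d by blast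
  qed
  then obtain d where d: "d \<in> {0, 1, 2}" and ok: "\<And>m. ?ok d m" by blast
  define z' where "z' = (\<lambda>j. z (3 * j - int d))"
  have "(shift ^^ d) (tau_bi n z') i = z i" for i
  proof -
    define j r where "j = (i + int d) div 3" and "r = (i + int d) mod 3"
    have r: "0 \<le> r" "r < 3" unfolding r_def by simp_all
    have i: "i = 3 * j + r - int d" unfolding j_def r_def by simp
    obtain q where q: "\<forall>i'. \<bar>i'\<bar> \<le> int (nat \<bar>i\<bar> + 3) \<longrightarrow> z i' = fixpoint n (3 * q + int d + i')"
      using ok by blast
    have "z' j = fixpoint n (3 * q + int d + (3 * j - int d))"
      unfolding z'_def by (rule q[rule_format]) (use i r in linarith)
    also have "\<dots> = fixpoint n (q + j)"
      using fixpoint_block[of 0 n "q + j"] by (simp add: tau_nth algebra_simps)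
    finally have "(shift ^^ d) (tau_bi n z') i = tau n (fixpoint n (q + j)) ! nat r"
      unfolding shift_tau_bi j_def r_def by simp
    also have "\<dots> = fixpoint n (3 * (q + j) + r)" by (rule fixpoint_block[OF r, symmetric])
    also have "\<dots> = fixpoint n (3 * q + int d + i)" unfolding i by (simp add: algebra_simps)
    also have "\<dots> = z i" using q by simp
    finally show ?thesis .
  qed
  then have "z = (shift ^^ d) (tau_bi n z')" by (intro ext) simp
  moreover have "\<exists>p. \<forall>i. \<bar>i\<bar> \<le> int m \<longrightarrow> z' i = fixpoint n (p + i)" for m
  proof -
    obtain q where q: "\<forall>i'. \<bar>i'\<bar> \<le> int (3 * m + 3) \<longrightarrow> z i' = fixpoint n (3 * q + int d + i')"
      using ok by blast
    have "z' i = fixpoint n (q + i)" if i: "\<bar>i\<bar> \<le> int m" for i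
    proof -
      have "z' i = fixpoint n (3 * q + int d + (3 * i - int d))"
        unfolding z'_def by (rule q[rule_format]) (use i d in auto)
      then show ?thesis
        using fixpoint_block[of 0 n "q + i"] by (simp add: tau_nth algebra_simps)
    qed
    then show ?thesis by blast
  qed
  then have "z' \<in> Xn n" by (simp add: Xn_eq_fixpoint_closure fixpoint_closure_def)
  ultimately show ?thesis using d by blast
qed

lemma desubstitution_exists:
  assumes "z \<in> Xn n"
  shows "\<exists>zs \<delta>. desubstitution n z zs \<delta>"
proof -
  obtain D S where DS: "\<And>w. w \<in> Xn n \<Longrightarrow>
      D w \<in> {0, 1, 2} \<and> S w \<in> Xn n \<and> w = (shift ^^ D w) (tau_bi n (S w))"
    using desubstitute_once[of _ n] by metis
  define zs where "zs = (\<lambda>i. (S ^^ i) z)"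
  have "zs i \<in> Xn n" for i
    by (induction i) (use assms DS in \<open>auto simp: zs_def\<close>)
  then have "desubstitution n z zs (\<lambda>i. D (zs i))"
    unfolding desubstitution_def odometer3_def using DS by (auto simp: zs_def)
  then show ?thesis by blast
qed

lemma Xn_has_nonzero:
  assumes n: "1 \<le> n" and z: "z \<in> Xn n"
  shows "\<exists>j. z j \<noteq> 0"
proof -
  obtain p where p: "\<And>i. \<bar>i\<bar> \<le> int 2 \<Longrightarrow> z i = fixpoint n (p + i)"
    using Xn_window[OF z] by blast
  have "z (2 - p mod 3) = fixpoint n (p + (2 - p mod 3))" by (rule p) auto
  also have "p + (2 - p mod 3) = 3 * (p div 3) + 2" by presburger
  finally have "z (2 - p mod 3) \<noteq> 0" using fixpoint_third_nonzero[OF n] by simp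
  then show ?thesis by blast
qed

text \<open>The middle letters of the blocks give a residue class modulo 3 on which \<open>z\<close> vanishes. If
  another phase were possible, \<open>z\<close> would also vanish on the first or on the third letters of its
  blocks. The first letters form a point of \<^term>\<open>Xn n\<close>, which is not identically zero, and the
  third letters are never zero.\<close>

lemma phase_unique:
  assumes n: "1 \<le> n" and w: "w \<in> Xn n" and w': "w' \<in> Xn n"
    and d: "d \<in> {0, 1, 2}" and d': "d' \<in> {0, 1, 2}"
    and eq: "(shift ^^ d) (tau_bi n w) = (shift ^^ d') (tau_bi n w')"
  shows "d = d'"
proof (rule ccontr)
  assume ne: "d \<noteq> d'"
  have zero: "tau n (w' ((i + int d') div 3)) ! nat ((i + int d') mod 3) = 0"
    if "(i + int d) mod 3 = 1" for i
    using fun_cong[OF eq, of i] that by (simp add: shift_tau_bi tau_nth)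
  \<comment> \<open>The place, in the blocks of \<open>w'\<close>, of the middle letters of the blocks of \<open>w\<close>.\<close>
  define r where "r = (1 + int d' - int d) mod 3"
  have "r = 0 \<or> r = 2" using ne d d' unfolding r_def by auto
  moreover have block: "tau n (w' j) ! nat r = 0" for j
  proof -
    have "(3 * j + r - int d' + int d) mod 3 = 1" using d d' unfolding r_def by (auto; presburger)
    from zero[OF this] show ?thesis unfolding r_def by simp
  qed
  ultimately show False
  proof (elim disjE)
    assume "r = 0"
    then have "w' j = 0" for j using block[of j] by (simp add: tau_nth)
    then show False using Xn_has_nonzero[OF n w'] by simp
  next
    assume "r = 2"
    then show False using block[of 0] n by (simp add: tau_nth split: if_splits)
  qed
qed

lemma shift_tau_bi_inj:
  assumes "(shift ^^ d) (tau_bi n w) = (shift ^^ d) (tau_bi n w')"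
  shows "w = w'"
proof
  fix j
  show "w j = w' j" using fun_cong[OF assms, of "3 * j - int d"]
    by (simp add: shift_tau_bi tau_nth)
qed

lemma desubstitutionD:
  assumes "desubstitution n z zs \<delta>"
  shows "zs i \<in> Xn n" "\<delta> i \<in> {0, 1, 2}" "zs 0 = z"
    "zs i = (shift ^^ \<delta> i) (tau_bi n (zs (i + 1)))"
proof -
  note all = assms[unfolded desubstitution_def]
  show "zs i \<in> Xn n" by (rule spec[OF conjunct1[OF all]])
  show "\<delta> i \<in> {0, 1, 2}"
    using conjunct1[OF conjunct2[OF all]] unfolding odometer3_def by blast
  show "zs 0 = z" by (rule conjunct1[OF conjunct2[OF conjunct2[OF all]]])
  show "zs i = (shift ^^ \<delta> i) (tau_bi n (zs (i + 1)))"
    by (rule spec[OF conjunct2[OF conjunct2[OF conjunct2[OF all]]]])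
qed

lemma desubstitution_unique:
  assumes n: "1 \<le> n" and D: "desubstitution n z zs \<delta>" and D': "desubstitution n z zs' \<delta>'"
  shows "zs = zs' \<and> \<delta> = \<delta>'"
proof -
  have step: "\<delta> i = \<delta>' i \<and> zs (i + 1) = zs' (i + 1)" if "zs i = zs' i" for i
  proof -
    have eq: "(shift ^^ \<delta> i) (tau_bi n (zs (i + 1))) = (shift ^^ \<delta>' i) (tau_bi n (zs' (i + 1)))"
      by (rule trans[OF trans[OF desubstitutionD(4)[OF D, symmetric] that] desubstitutionD(4)[OF D']])
    then have d: "\<delta> i = \<delta>' i"
      by (rule phase_unique[OF n desubstitutionD(1)[OF D] desubstitutionD(1)[OF D']
            desubstitutionD(2)[OF D] desubstitutionD(2)[OF D']])
    show ?thesis using d shift_tau_bi_inj[OF eq[unfolded d]] by blast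
  qed
  have zs: "zs i = zs' i" for i
  proof (induction i)
    case 0
    then show ?case using desubstitutionD(3)[OF D] desubstitutionD(3)[OF D'] by simp
  next
    case (Suc i)
    then show ?case using step by simp
  qed
  have "\<delta> i = \<delta>' i" for i by (rule conjunct1[OF step[OF zs]])
  with zs show ?thesis by (simp add: fun_eq_iff)
qed

lemma pi_n_eq:
  assumes n: "1 \<le> n" and D: "desubstitution n z zs \<delta>"
  shows "pi_n n z = \<delta>"
  unfolding pi_n_def
proof (rule the_equality)
  show "\<exists>zs. desubstitution n z zs \<delta>" using D by blast
next
  fix \<delta>' assume "\<exists>zs. desubstitution n z zs \<delta>'"
  then obtain zs' where "desubstitution n z zs' \<delta>'" by blast
  then show "\<delta>' = \<delta>" by (rule desubstitution_unique[OF n _ D, THEN conjunct2])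
qed

lemma rho_desubstitution:
  assumes D: "desubstitution (n + 1) z zs \<delta>"
  shows "desubstitution n (rho n \<circ> z) (\<lambda>i. rho n \<circ> zs i) \<delta>"
proof -
  note mem = desubstitutionD(1)[OF D]
  have rec: "rho n \<circ> zs i = (shift ^^ \<delta> i) (tau_bi n (rho n \<circ> zs (i + 1)))" for i
  proof
    fix j
    from fun_cong[OF desubstitutionD(4)[OF D, of i], of j]
    have "zs i j = tau (n + 1) (zs (i + 1) ((j + int (\<delta> i)) div 3)) ! nat ((j + int (\<delta> i)) mod 3)"
      by (simp only: shift_tau_bi)
    moreover have "nat ((j + int (\<delta> i)) mod 3) < 3" by (simp add: nat_less_iff)
    ultimately show "(rho n \<circ> zs i) j = (shift ^^ \<delta> i) (tau_bi n (rho n \<circ> zs (i + 1))) j"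
      using rho_tau[OF Xn_le[OF mem]] by (simp add: shift_tau_bi)
  qed
  have in_X: "rho n \<circ> zs i \<in> Xn n" for i by (rule rho_Xn[OF mem])
  have "\<delta> \<in> odometer3" using desubstitutionD(2)[OF D] by (simp add: odometer3_def)
  moreover have "rho n \<circ> zs 0 = rho n \<circ> z" using desubstitutionD(3)[OF D] by simp
  ultimately show ?thesis
    unfolding desubstitution_def by - (intro conjI allI in_X rec)
qed

section \<open>Letters of the inverse limit\<close>

text \<open>The inverse limit of the alphabets along the maps \<open>rho\<close>. The index is shifted by one, so that
  \<open>f n\<close> is a letter of \<open>alphabet (n + 1)\<close>.\<close>

definition compatible :: "(nat \<Rightarrow> nat) set" where
  "compatible = {f. \<forall>n. f n \<le> n + 1 \<and> rho (n + 1) (f (n + 1)) = f n}"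

text \<open>The elements are \<open>n \<mapsto> min (n + 1) c\<close> for \<open>c\<close> a natural number or infinity: the first index at
  which the letter is not maximal fixes all later letters, and maximality propagates downwards.\<close>

lemma countable_compatible: "countable compatible"
proof (rule countable_subset)
  show "compatible \<subseteq> insert Suc (range (\<lambda>c n. min (Suc n) c))"
  proof
    fix f assume "f \<in> compatible"
    then have le: "\<And>n. f n \<le> Suc n" and comp: "\<And>n. rho (Suc n) (f (Suc n)) = f n"
      unfolding compatible_def by auto
    have up: "f (Suc n) = f n" if "f n \<le> n" for n
      using that comp[of n] by (auto simp: rho_def split: if_splits)
    have down: "f n = Suc n" if "f (Suc n) = Suc (Suc n)" for n
      using that comp[of n] by (auto simp: rho_def split: if_splits)
    show "f \<in> insert Suc (range (\<lambda>c n. min (Suc n) c))"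
    proof (cases "\<exists>m. f m \<le> m")
      case False
      then have "f n = Suc n" for n using le[of n] by (simp add: not_le le_antisym Suc_leI)
      then have "f = Suc" by blast
      then show ?thesis by simp
    next
      case True
      define m where "m = (LEAST m. f m \<le> m)"
      have m: "f m \<le> m" and least: "\<And>n. n < m \<Longrightarrow> \<not> f n \<le> n"
        unfolding m_def using LeastI_ex[OF True] not_less_Least by blast+
      have above: "f n = f m" if "m \<le> n" for n
        using that
      proof (induction n rule: dec_induct)
        case base
        then show ?case by simp
      next
        case (step n)
        then show ?case using up[of n] m by simp
      qed
      have below: "f n = Suc n" if "n < m" for n
        using least[OF that] le[of n] by simp
      have fm: "m \<le> f m"
      proof (cases m)
        case (Suc k)
        then have "f k = Suc k" using below by simp
        then show ?thesis using comp[of k] Suc by (auto simp: rho_def split: if_splits)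
      qed simp
      have "f n = min (Suc n) (f m)" for n
        using above[of n] below[of n] m fm by (cases "m \<le> n") auto
      then have "f = (\<lambda>n. min (Suc n) (f m))" by blast
      then show ?thesis by blast
    qed
  qed
qed simp

section \<open>Towers of desubstitutions\<close>

text \<open>\<open>L k j\<close> stands for the letters at coordinate \<open>j\<close> of the \<open>k\<close>-fold desubstitutions, taken over all
  alphabets simultaneously. The node \<open>(k, j)\<close> lies in the block generated by its parent
  \<open>(k + 1, (j + \<delta> k) div 3)\<close>, at the place given by the remainder.\<close>

definition tower :: "(nat \<Rightarrow> nat) \<Rightarrow> (nat \<Rightarrow> int \<Rightarrow> nat \<Rightarrow> nat) \<Rightarrow> bool" where
  "tower \<delta> L \<longleftrightarrow> (\<forall>k j. L k j \<in> compatible) \<and>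
    (\<forall>k j n. L k j n = tau (n + 1) (L (k + 1) ((j + int (\<delta> k)) div 3) n) ! nat ((j + int (\<delta> k)) mod 3))"

text \<open>The coordinate at level \<open>m\<close> of the ancestor of the node \<open>(0, i)\<close>.\<close>

primrec ancestor :: "(nat \<Rightarrow> nat) \<Rightarrow> int \<Rightarrow> nat \<Rightarrow> int" where
  "ancestor \<delta> i 0 = i"
| "ancestor \<delta> i (Suc m) = (ancestor \<delta> i m + int (\<delta> m)) div 3"

lemma ancestor_mono: "i \<le> i' \<Longrightarrow> ancestor \<delta> i m \<le> ancestor \<delta> i' m"
  by (induction m) (auto intro: zdiv_mono1)

lemma digit_le:
  assumes "\<delta> \<in> odometer3"
  shows "\<delta> k \<le> 2"
proof -
  have "\<delta> k \<in> {0, 1, 2}" using assms unfolding odometer3_def by blast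
  then show ?thesis by auto
qed

lemma ancestor_0:
  assumes "\<delta> \<in> odometer3"
  shows "ancestor \<delta> 0 m = 0"
proof (induction m)
  case (Suc m)
  then show ?case using digit_le[OF assms, of m] by (simp add: div_eq_0_iff)
qed simp

text \<open>Taking parents strictly decreases the absolute value of a coordinate outside \<open>{-1, 0, 1}\<close>.\<close>

lemma ancestor_bound:
  assumes \<delta>: "\<delta> \<in> odometer3"
  shows "\<bar>ancestor \<delta> i m\<bar> \<le> 1 \<or> \<bar>ancestor \<delta> i m\<bar> + int m \<le> \<bar>i\<bar>"
proof (induction m)
  case 0
  then show ?case by simp
next
  case (Suc m)
  define a q where "a = ancestor \<delta> i m" and "q = ancestor \<delta> i (Suc m)"
  have "q = (a + int (\<delta> m)) div 3" unfolding a_def q_def by simp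
  then have "3 * q \<le> a + int (\<delta> m)" "a + int (\<delta> m) \<le> 3 * q + 2" by linarith+
  moreover have "0 \<le> int (\<delta> m)" "int (\<delta> m) \<le> 2" using digit_le[OF \<delta>, of m] by auto
  ultimately have "\<bar>q\<bar> \<le> 1 \<or> \<bar>q\<bar> < \<bar>a\<bar>" by linarith
  with Suc show ?case unfolding a_def q_def by linarith
qed

lemma ancestor_small:
  assumes \<delta>: "\<delta> \<in> odometer3" and "\<bar>i\<bar> \<le> int m"
  shows "\<bar>ancestor \<delta> i m\<bar> \<le> 1"
  using ancestor_bound[OF \<delta>, of i m] assms(2) by linarith

definition paths_merge :: "(nat \<Rightarrow> nat) \<Rightarrow> int \<Rightarrow> int \<Rightarrow> bool" where
  "paths_merge \<delta> i i' \<longleftrightarrow> (\<exists>m. ancestor \<delta> i m = ancestor \<delta> i' m)"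

text \<open>The path of \<open>0\<close> stays at \<open>0\<close>. By monotonicity, the path of a positive coordinate that never meets
  it stays positive, hence is eventually constant \<open>1\<close>; so any two such paths meet. The same holds on
  the negative side with \<open>-1\<close>. Therefore \<open>0\<close>, one exceptional positive coordinate and one exceptional
  negative coordinate suffice.\<close>

lemma three_representatives:
  assumes \<delta>: "\<delta> \<in> odometer3"
  obtains a b where "\<And>i. paths_merge \<delta> i 0 \<or> paths_merge \<delta> i a \<or> paths_merge \<delta> i b"
proof -
  have pos: "paths_merge \<delta> i i'" if i: "0 < i" "\<not> paths_merge \<delta> i 0" and i': "0 < i'" "\<not> paths_merge \<delta> i' 0" for i i'
  proof -
    have *: "ancestor \<delta> l m = 1" if "0 < l" "\<not> paths_merge \<delta> l 0" "\<bar>l\<bar> \<le> int m" for l m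
    proof -
      have "0 \<le> ancestor \<delta> l m" using ancestor_mono[of 0 l \<delta> m] ancestor_0[OF \<delta>] that by simp
      moreover have "ancestor \<delta> l m \<noteq> 0" using that(2) ancestor_0[OF \<delta>] unfolding paths_merge_def by auto
      ultimately show ?thesis using ancestor_small[OF \<delta> that(3)] by linarith
    qed
    have "ancestor \<delta> i (nat (\<bar>i\<bar> + \<bar>i'\<bar>)) = ancestor \<delta> i' (nat (\<bar>i\<bar> + \<bar>i'\<bar>))"
      using *[OF i] *[OF i'] by simp
    then show ?thesis unfolding paths_merge_def by blast
  qed
  have neg: "paths_merge \<delta> i i'" if i: "i < 0" "\<not> paths_merge \<delta> i 0" and i': "i' < 0" "\<not> paths_merge \<delta> i' 0" for i i'
  proof -
    have *: "ancestor \<delta> l m = -1" if "l < 0" "\<not> paths_merge \<delta> l 0" "\<bar>l\<bar> \<le> int m" for l m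
    proof -
      have "ancestor \<delta> l m \<le> 0" using ancestor_mono[of l 0 \<delta> m] ancestor_0[OF \<delta>] that by simp
      moreover have "ancestor \<delta> l m \<noteq> 0" using that(2) ancestor_0[OF \<delta>] unfolding paths_merge_def by auto
      ultimately show ?thesis using ancestor_small[OF \<delta> that(3)] by linarith
    qed
    have "ancestor \<delta> i (nat (\<bar>i\<bar> + \<bar>i'\<bar>)) = ancestor \<delta> i' (nat (\<bar>i\<bar> + \<bar>i'\<bar>))"
      using *[OF i] *[OF i'] by simp
    then show ?thesis unfolding paths_merge_def by blast
  qed
  \<comment> \<open>If there is no exceptional coordinate on one side, the value chosen there is arbitrary.\<close>
  define a where "a = (SOME i. 0 < i \<and> \<not> paths_merge \<delta> i 0)"
  define b where "b = (SOME i. i < 0 \<and> \<not> paths_merge \<delta> i 0)"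
  have "paths_merge \<delta> i 0 \<or> paths_merge \<delta> i a \<or> paths_merge \<delta> i b" for i
  proof (cases "paths_merge \<delta> i 0")
    case False
    have "paths_merge \<delta> 0 0" unfolding paths_merge_def by simp
    with False have "i \<noteq> 0" by metis
    then consider "0 < i" | "i < 0" using linorder_less_linear[of 0 i] by blast
    then show ?thesis
    proof cases
      case 1
      then have "0 < a \<and> \<not> paths_merge \<delta> a 0"
        unfolding a_def using someI[of "\<lambda>i. 0 < i \<and> \<not> paths_merge \<delta> i 0" i] False by simp
      then show ?thesis using pos[of i a] 1 False by blast
    next
      case 2
      then have "b < 0 \<and> \<not> paths_merge \<delta> b 0"
        unfolding b_def using someI[of "\<lambda>i. i < 0 \<and> \<not> paths_merge \<delta> i 0" i] False by simp
      then show ?thesis using neg[of i b] 2 False by blast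
    qed
  qed simp
  then show thesis by (rule that)
qed

lemma tower_down:
  assumes "tower \<delta> L" "tower \<delta> L'"
    and "L (k + 1) ((j + int (\<delta> k)) div 3) = L' (k + 1) ((j + int (\<delta> k)) div 3)"
  shows "L k j = L' k j"
proof
  fix n
  show "L k j n = L' k j n"
    using assms unfolding tower_def by metis
qed

text \<open>The middle letter of every block is \<open>0\<close>, whatever its parent.\<close>

lemma tower_middle:
  assumes "tower \<delta> L" "tower \<delta> L'" and "(j + int (\<delta> k)) mod 3 = 1"
  shows "L k j = L' k j"
proof
  fix n
  have zero: "K k j n = 0" if "tower \<delta> K" for K
  proof -
    have "K k j n = tau (n + 1) (K (k + 1) ((j + int (\<delta> k)) div 3) n) ! nat ((j + int (\<delta> k)) mod 3)"
      using that unfolding tower_def by blast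
    then show ?thesis using assms(3) by (simp add: tau_nth)
  qed
  show "L k j n = L' k j n" using zero[OF assms(1)] zero[OF assms(2)] by simp
qed

text \<open>At the first place of a block the parent is copied. At the third place it is replaced by its
  successor, truncated to the alphabet: for a single alphabet this loses information, as the letters
  \<open>n - 1\<close> and \<open>n\<close> have the same image \<open>n\<close>. Reading the child in the next larger alphabet separates
  them, and subtracting \<open>1\<close> there yields the parent.\<close>

lemma tower_parent:
  assumes "tower \<delta> K" and ne: "(j + int (\<delta> k)) mod 3 \<noteq> 1"
  shows "K (k + 1) ((j + int (\<delta> k)) div 3) n =
    (if (j + int (\<delta> k)) mod 3 = 0 then K k j n else K k j (n + 1) - 1)"
proof -
  let ?p = "K (k + 1) ((j + int (\<delta> k)) div 3)"
  have rec: "K k j m = tau (m + 1) (?p m) ! nat ((j + int (\<delta> k)) mod 3)" for m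
    using assms(1) unfolding tower_def by blast
  have "?p \<in> compatible" using assms(1) unfolding tower_def by blast
  then have p: "?p (n + 1) \<le> n + 2" "rho (n + 1) (?p (n + 1)) = ?p n"
    by (simp_all add: compatible_def)
  have "(j + int (\<delta> k)) mod 3 = 0 \<or> (j + int (\<delta> k)) mod 3 = 2" using ne by presburger
  then consider "(j + int (\<delta> k)) mod 3 = 0" | "(j + int (\<delta> k)) mod 3 = 2" by blast
  then show ?thesis
  proof cases
    case 1
    then show ?thesis using rec[of n] by (simp add: tau_nth)
  next
    case 2
    then have "K k j (n + 1) = (if ?p (n + 1) = n + 2 then n + 2 else ?p (n + 1) + 1)"
      using rec[of "n + 1"] by (simp add: tau_nth)
    then show ?thesis using p 2 by (auto simp: rho_def split: if_splits)
  qed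
qed

lemma tower_up:
  assumes "tower \<delta> L" "tower \<delta> L'" and "(j + int (\<delta> k)) mod 3 \<noteq> 1" and "L k j = L' k j"
  shows "L (k + 1) ((j + int (\<delta> k)) div 3) = L' (k + 1) ((j + int (\<delta> k)) div 3)"
  using tower_parent[OF assms(1,3)] tower_parent[OF assms(2,3)] assms(4) by (intro ext) simp

lemma tower_path_down:
  assumes T: "tower \<delta> L" "tower \<delta> L'" and "m \<le> M"
    and eq: "L M (ancestor \<delta> i M) = L' M (ancestor \<delta> i M)"
  shows "L m (ancestor \<delta> i m) = L' m (ancestor \<delta> i m)"
  using \<open>m \<le> M\<close>
proof (induction m rule: inc_induct)
  case base
  then show ?case by (rule eq)
next
  case (step m)
  show ?case by (rule tower_down[OF T]) (use step.IH in simp)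
qed

text \<open>Along the path of one coordinate, some level determines all others, with \<open>m\<close> depending only on
  \<open>\<delta>\<close> and \<open>i\<close>. If the path passes through middle places infinitely often, it is determined without
  any information, as every node lies below a middle letter. Otherwise beyond some level each node
  determines its parent.\<close>

lemma tower_path_anchor:
  obtains m where "\<And>L L' M. tower \<delta> L \<Longrightarrow> tower \<delta> L' \<Longrightarrow>
    L m (ancestor \<delta> i m) = L' m (ancestor \<delta> i m) \<Longrightarrow> L M (ancestor \<delta> i M) = L' M (ancestor \<delta> i M)"
proof (cases "\<forall>M. \<exists>m\<ge>M. (ancestor \<delta> i m + int (\<delta> m)) mod 3 = 1")
  case True
  have "L M (ancestor \<delta> i M) = L' M (ancestor \<delta> i M)" if T: "tower \<delta> L" "tower \<delta> L'" for L L' M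
  proof -
    obtain m where m: "m \<ge> M" "(ancestor \<delta> i m + int (\<delta> m)) mod 3 = 1" using True by blast
    show ?thesis by (rule tower_path_down[OF T m(1) tower_middle[OF T m(2)]])
  qed
  then show thesis by (rule that)
next
  case False
  then obtain m where m: "\<And>k. k \<ge> m \<Longrightarrow> (ancestor \<delta> i k + int (\<delta> k)) mod 3 \<noteq> 1" by blast
  have "L M (ancestor \<delta> i M) = L' M (ancestor \<delta> i M)"
    if T: "tower \<delta> L" "tower \<delta> L'" and eq: "L m (ancestor \<delta> i m) = L' m (ancestor \<delta> i m)" for L L' M
  proof (cases "m \<le> M")
    case True
    then show ?thesis
    proof (induction M rule: dec_induct)
      case base
      then show ?case by (rule eq)
    next
      case (step k)
      then show ?case using tower_up[OF T m[OF step.hyps(1)]] by simp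
    qed
  next
    case False
    then show ?thesis using tower_path_down[OF T _ eq] by simp
  qed
  then show thesis by (rule that)
qed

text \<open>A tower is coded by three elements of \<^const>\<open>compatible\<close>, the letters at the determining nodes on
  the paths of three representatives. The code fixes these paths, and every other path meets one of
  them, so that its lower part, and in particular its letter at level \<open>0\<close>, is determined as well.\<close>

lemma countable_towers:
  assumes \<delta>: "\<delta> \<in> odometer3"
  shows "countable {L 0 | L. tower \<delta> L}"
proof -
  obtain a b where reps: "\<And>i. paths_merge \<delta> i 0 \<or> paths_merge \<delta> i a \<or> paths_merge \<delta> i b"
    using three_representatives[OF \<delta>] by blast
  have "\<forall>i. \<exists>m. \<forall>L L' M. tower \<delta> L \<longrightarrow> tower \<delta> L' \<longrightarrow>
      L m (ancestor \<delta> i m) = L' m (ancestor \<delta> i m) \<longrightarrow>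
      L M (ancestor \<delta> i M) = L' M (ancestor \<delta> i M)"
  proof
    fix i
    obtain m where "\<And>L L' M. tower \<delta> L \<Longrightarrow> tower \<delta> L' \<Longrightarrow>
      L m (ancestor \<delta> i m) = L' m (ancestor \<delta> i m) \<Longrightarrow>
      L M (ancestor \<delta> i M) = L' M (ancestor \<delta> i M)"
      using tower_path_anchor[of \<delta> i] by blast
    then show "\<exists>m. \<forall>L L' M. tower \<delta> L \<longrightarrow> tower \<delta> L' \<longrightarrow>
      L m (ancestor \<delta> i m) = L' m (ancestor \<delta> i m) \<longrightarrow>
      L M (ancestor \<delta> i M) = L' M (ancestor \<delta> i M)" by blast
  qed
  then obtain h where h: "\<And>i L L' M. tower \<delta> L \<Longrightarrow> tower \<delta> L' \<Longrightarrow>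
      L (h i) (ancestor \<delta> i (h i)) = L' (h i) (ancestor \<delta> i (h i)) \<Longrightarrow>
      L M (ancestor \<delta> i M) = L' M (ancestor \<delta> i M)"
    by metis
  define v where "v = (\<lambda>i L. L (h i) (ancestor \<delta> i (h i)) :: nat \<Rightarrow> nat)"
  define code where "code = (\<lambda>L. (v 0 L, v a L, v b L))"
  have bottom: "L 0 = L' 0" if T: "tower \<delta> L" "tower \<delta> L'" and eq: "code L = code L'" for L L'
  proof
    fix i
    obtain r where r: "paths_merge \<delta> i r" "v r L = v r L'"
      using reps[of i] eq unfolding code_def by auto
    then obtain m where m: "ancestor \<delta> i m = ancestor \<delta> r m" unfolding paths_merge_def by blast
    have "L m (ancestor \<delta> i m) = L' m (ancestor \<delta> i m)"
      unfolding m using h[OF T] r(2) unfolding v_def by blast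
    then show "L 0 i = L' 0 i" using tower_path_down[OF T, of 0 m i] by simp
  qed
  have "code ` {L. tower \<delta> L} \<subseteq> compatible \<times> compatible \<times> compatible"
    unfolding code_def v_def tower_def by auto
  then have "countable (code ` {L. tower \<delta> L})"
    using countable_subset countable_compatible by (meson countable_SIGMA)
  then have "countable ((\<lambda>c. inv_into {L. tower \<delta> L} code c 0) ` code ` {L. tower \<delta> L})"
    by (rule countable_image)
  moreover have "{L 0 | L. tower \<delta> L} \<subseteq>
      (\<lambda>c. inv_into {L. tower \<delta> L} code c 0) ` code ` {L. tower \<delta> L}"
  proof
    fix f assume "f \<in> {L 0 | L. tower \<delta> L}"
    then obtain L where L: "f = L 0" "tower \<delta> L" by blast
    define K where "K = inv_into {L. tower \<delta> L} code (code L)"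
    have code_L: "code L \<in> code ` {L. tower \<delta> L}" by (rule imageI) (simp add: L(2))
    have "tower \<delta> K" using inv_into_into[OF code_L] unfolding K_def by simp
    moreover have "code L = code K" using f_inv_into_f[OF code_L] unfolding K_def by simp
    ultimately have "f = K 0" using bottom[OF L(2)] L(1) by simp
    then show "f \<in> (\<lambda>c. inv_into {L. tower \<delta> L} code c 0) ` code ` {L. tower \<delta> L}"
      unfolding K_def using code_L by (rule image_eqI)
  qed
  ultimately show ?thesis by (rule countable_subset[rotated])
qed

section \<open>Fibres of the odometer factor\<close>

text \<open>Desubstitutions in the various alphabets fit together: the image under \<open>rho n\<close> of a
  desubstitution of \<open>x (n + 1)\<close> is one of \<open>x n\<close>, and uniqueness identifies it with the given one.\<close>

lemma inv_lim_tower: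
  assumes x: "x \<in> inv_lim"
  shows "\<exists>L. tower (pi_lim x) L \<and> L 0 = (\<lambda>i n. x (n + 1) i)"
proof -
  have mem: "x n \<in> Xn n" if "1 \<le> n" for n
    using x that unfolding inv_lim_def by auto
  have comp: "rho n \<circ> x (n + 1) = x n" if "1 \<le> n" for n
    using x that unfolding inv_lim_def by blast
  have "\<forall>n. \<exists>zs \<delta>. 1 \<le> n \<longrightarrow> desubstitution n (x n) zs \<delta>"
    using desubstitution_exists[OF mem] by blast
  then obtain Z D where D: "\<And>n. 1 \<le> n \<Longrightarrow> desubstitution n (x n) (Z n) (D n)" by metis
  have step: "(\<lambda>i. rho n \<circ> Z (n + 1) i) = Z n \<and> D (n + 1) = D n" if n: "1 \<le> n" for n
  proof -
    have "desubstitution n (x n) (\<lambda>i. rho n \<circ> Z (n + 1) i) (D (n + 1))"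
      using rho_desubstitution[OF D[of "n + 1"]] comp[OF n] by simp
    then show ?thesis using desubstitution_unique[OF n _ D[OF n]] by blast
  qed
  have const: "D n = D 1" if "1 \<le> n" for n
    using that by (induction n rule: dec_induct) (use step in auto)
  have "pi_n n (x n) = D 1" if "1 \<le> n" for n
    using pi_n_eq[OF that D[OF that]] const[OF that] by simp
  then have pi: "pi_lim x = D 1"
    unfolding pi_lim_def by (intro the_equality) auto
  define L where "L = (\<lambda>k j n. Z (n + 1) k j)"
  have "L k j \<in> compatible" for k j
  proof -
    have "Z (n + 1) k j \<le> n + 1" for n
      by (rule Xn_le[OF desubstitutionD(1)[OF D]]) simp
    moreover have "rho (n + 1) (Z (n + 1 + 1) k j) = Z (n + 1) k j" for n
      using fun_cong[OF fun_cong[OF conjunct1[OF step[of "n + 1"]], of k], of j] by simp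
    ultimately show ?thesis unfolding compatible_def L_def by simp
  qed
  moreover have "L k j n =
      tau (n + 1) (L (k + 1) ((j + int (D 1 k)) div 3) n) ! nat ((j + int (D 1 k)) mod 3)" for k j n
  proof -
    have "Z (n + 1) k = (shift ^^ D (n + 1) k) (tau_bi (n + 1) (Z (n + 1) (k + 1)))"
      by (rule desubstitutionD(4)[OF D]) simp
    from fun_cong[OF this, of j] show ?thesis
      unfolding shift_tau_bi L_def using const[of "n + 1"] by simp
  qed
  ultimately have "tower (pi_lim x) L" unfolding tower_def pi by blast
  moreover have "L 0 = (\<lambda>i n. x (n + 1) i)"
  proof -
    have "Z (n + 1) 0 = x (n + 1)" for n
      by (rule desubstitutionD(3)[OF D]) simp
    then show ?thesis unfolding L_def by simp
  qed
  ultimately show ?thesis by blast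
qed

theorem proposition4p3:
  fixes \<delta> :: "nat \<Rightarrow> nat"
  assumes "\<delta> \<in> odometer3"
  shows "countable {x \<in> inv_lim. pi_lim x = \<delta>}"
proof -
  let ?F = "{x \<in> inv_lim. pi_lim x = \<delta>}"
  let ?f = "\<lambda>x i n. x (n + 1) i :: nat"
  have "?f ` ?F \<subseteq> {L 0 | L. tower \<delta> L}"
  proof (rule image_subsetI)
    fix x assume x: "x \<in> ?F"
    then obtain L where "tower \<delta> L" "L 0 = ?f x" using inv_lim_tower[of x] by auto
    then have "?f x = L 0 \<and> tower \<delta> L" by simp
    then show "?f x \<in> {L 0 | L. tower \<delta> L}" by (intro CollectI exI)
  qed
  then have "countable (?f ` ?F)" by (rule countable_subset[OF _ countable_towers[OF assms]])
  moreover have "inj_on ?f ?F"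
  proof (rule inj_onI)
    fix x y assume x: "x \<in> ?F" and y: "y \<in> ?F" and eq: "?f x = ?f y"
    have ext: "x \<in> extensional {1..}" "y \<in> extensional {1..}"
      using x y unfolding inv_lim_def PiE_def by auto
    show "x = y"
    proof (rule extensionalityI[OF ext])
      fix n :: nat assume "n \<in> {1..}"
      then have n: "n - 1 + 1 = n" by simp
      show "x n = y n"
      proof
        fix i
        show "x n i = y n i" using fun_cong[OF fun_cong[OF eq, of i], of "n - 1"] unfolding n .
      qed
    qed
  qed
  ultimately show ?thesis by (rule countable_image_inj_on)
qed

end
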